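(* As $d\to\infty$, the covering number $H(d)$ satisfies $$H(d)\leq 2^d\bigl(d\log d+d\log\log d+O(d)\bigr),$$ with an absolute implicit constant; that is, there are absolute constants $C>0$ and $d_0$ such that $H(d)\leq 2^d\bigl(d\log d+d\log\log d+Cd\bigr)$ for all integers $d\geq d_0$. In particular, $H(d)=2^{d+O(\log d)}$ as $d\to\infty$; that is, there are absolute constants $C'>0$ and $d_1$ such that $2^{d-C'\log d}\leq H(d)\leq 2^{d+C'\log d}$ for all integers $d\geq d_1$.
   Context: A convex body in $\mathbb{R}^d$ is a compact convex subset of $\mathbb{R}^d$ with nonempty interior. For a convex body $K\subset\mathbb{R}^d$, a smaller positive homothet of $K$ is a set of the form $z+\lambda K$ with $z\in\mathbb{R}^d$ and $0<\lambda<1$. $H(K)$ is the least number of smaller positive homothets of $K$ whose union contains $K$. Define $H(d)=\sup_K H(K)$, the supremum being over all convex bodies $K\subset\mathbb{R}^d$. Here $\log$ is the natural logarithm. *)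

theory Defs
  imports "HOL-Analysis.Analysis"
begin

text \<open>
  The dimension has to be a variable that can be quantified inside a formula, so the space of
  dimension \<open>d\<close> is the library's \<^const>\<open>Euclidean_space\<close> \<open>d\<close>: the functions \<open>nat \<Rightarrow> real\<close>
  that vanish from index \<open>d\<close> on, with the product topology. The type \<open>nat \<Rightarrow> real\<close> has no
  \<^class>\<open>real_vector\<close> instance, so convexity and homothets are written coordinatewise.
\<close>

definition convex_body :: "nat \<Rightarrow> (nat \<Rightarrow> real) set \<Rightarrow> bool" where
  "convex_body d K \<longleftrightarrow>
     compactin (Euclidean_space d) K \<and>
     (\<forall>x\<in>K. \<forall>y\<in>K. \<forall>u\<ge>0. \<forall>v\<ge>0. u + v = 1 \<longrightarrow> (\<lambda>i. u * x i + v * y i) \<in> K) \<and>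
     Euclidean_space d interior_of K \<noteq> {}"

definition smaller_homothet :: "nat \<Rightarrow> (nat \<Rightarrow> real) set \<Rightarrow> (nat \<Rightarrow> real) set \<Rightarrow> bool" where
  "smaller_homothet d K S \<longleftrightarrow>
     (\<exists>z\<in>topspace (Euclidean_space d). \<exists>l::real. 0 < l \<and> l < 1 \<and>
        S = (\<lambda>x i. z i + l * x i) ` K)"

text \<open>
  Both numbers are extended naturals: an infimum over no coverings or a supremum over an unbounded
  family is \<open>\<infinity>\<close>, so that an upper bound on them includes the assertion that they are finite.
\<close>

definition covering_number :: "nat \<Rightarrow> (nat \<Rightarrow> real) set \<Rightarrow> enat" where
  "covering_number d K =
     Inf {enat (card F) | F. finite F \<and> (\<forall>S\<in>F. smaller_homothet d K S) \<and> K \<subseteq> \<Union>F}"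

definition max_covering_number :: "nat \<Rightarrow> enat" where
  "max_covering_number d = (SUP K\<in>{K. convex_body d K}. covering_number d K)"

end

theory Submission
  imports Defs "HOL-Library.Function_Algebras"
begin

text \<open>
  The lower bound is the unit cube: a homothet of ratio less than \<open>1\<close> contains at most one of its
  \<open>2 ^ d\<close> vertices (\<open>covering_number_unit_cube\<close>).

  The upper bound rests on a fractional statement, \<open>translate_capturing_many_points\<close>: among the points
  of any finite \<open>A \<subseteq> K\<close>, some translate of \<open>l K\<close> contains at least the proportion
  \<open>p = (l / (1 + l)) ^ d\<close>, which is close to \<open>2 ^ - d\<close> for \<open>l\<close> close to \<open>1\<close>. The sets \<open>a + l K\<close> with
  \<open>a \<in> A\<close> all lie in \<open>(1 + l) K\<close>, so by Cauchy-Schwarz the average over pairs \<open>a, b\<close> of the volume of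
  \<open>(a + l K) \<inter> (b + l K)\<close> is at least \<open>p\<close> times the volume of \<open>l K\<close>. That volume depends on
  \<open>a - b\<close> only up to sign. The sign is what matters for a body that is not centrally symmetric:
  a point common to many of the sets \<open>a + l K\<close> only says that a translate of \<open>- l K\<close> captures many
  points of \<open>A\<close>, whereas pairs can be read in the opposite order and give a translate of \<open>l K\<close>.

  Choosing such translates greedily, the number of points that remain uncovered shrinks by the factor
  \<open>1 - p\<close> at each step, so about \<open>ln (card A) / p\<close> translates cover \<open>A\<close> (\<open>greedy_cover\<close>).

  To pass from points to \<open>K\<close>, take for \<open>A\<close> a net such that the sets \<open>a + e (K - c)\<close> cover \<open>K\<close>
  (\<open>small_net\<close>). Such a net with \<open>(9 / e) ^ d\<close> points comes from packing copies of a symmetric convex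
  subset of \<open>K - c\<close> whose volume is at least \<open>3 ^ - d\<close> times that of \<open>K\<close> (\<open>symmetric_section\<close>). With
  \<open>l = 1 - 2 e\<close>, the translates covering \<open>A\<close> enlarge to homothets of ratio \<open>1 - e\<close> that cover \<open>K\<close>
  (\<open>homothet_cover\<close>). Their number is about \<open>(1 + 1 / l) ^ d * d * ln (9 / e)\<close>, and
  \<open>e = 1 / (d * ln d)\<close> makes the first factor \<open>2 ^ d * (1 + O(1 / ln d))\<close> and the logarithm
  \<open>ln d + ln (ln d) + O(1)\<close>.
\<close>

section \<open>Homothets of convex sets\<close>

definition homothet :: "'a::real_vector \<Rightarrow> real \<Rightarrow> 'a set \<Rightarrow> 'a set" where
  "homothet z c S = (\<lambda>x. z + c *\<^sub>R x) ` S"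

lemma homothetI: "x \<in> S \<Longrightarrow> y = z + c *\<^sub>R x \<Longrightarrow> y \<in> homothet z c S"
  by (auto simp: homothet_def)

lemma homothetE:
  assumes "y \<in> homothet z c S"
  obtains x where "x \<in> S" "y = z + c *\<^sub>R x"
  using assms by (auto simp: homothet_def)

lemma homothet_add_subset:
  assumes "convex K" "0 < a" "0 < b" "x \<in> homothet u a K" "y \<in> homothet v b K"
  shows "x + y \<in> homothet (u + v) (a + b) K"
proof -
  obtain p q where p: "p \<in> K" "x = u + a *\<^sub>R p" and q: "q \<in> K" "y = v + b *\<^sub>R q"
    using assms by (auto elim!: homothetE)
  define r where "r = (a / (a + b)) *\<^sub>R p + (b / (a + b)) *\<^sub>R q"
  have "r \<in> K"
    unfolding r_def using assms p q by (intro convexD) (auto simp flip: add_divide_distrib)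
  moreover have "(a + b) *\<^sub>R r = a *\<^sub>R p + b *\<^sub>R q"
    using assms by (simp add: r_def scaleR_add_right)
  ultimately show ?thesis
    by (intro homothetI[where x = r]) (simp_all add: p q)
qed

section \<open>Covering a convex set by homothets\<close>

text \<open>
  The volume arguments use only that the maps \<open>x \<mapsto> t + c x\<close> with \<open>t \<in> E\<close> scale volume by
  \<open>\<bar>c\<bar> ^ d\<close>. The subspace \<open>E\<close> is where the measure lives: \<open>d\<close>-dimensional volume on a space of
  larger dimension is invariant only under translations along \<open>E\<close>.
\<close>

locale homogeneous_measure = sigma_finite_measure M for M :: "'a::real_vector measure" +
  fixes E :: "'a set" and d :: nat
  assumes space_eq_UNIV: "space M = UNIV"
    and subspace_E: "subspace E"
    and diff_measurable: "(\<lambda>(x, y). x - y) \<in> M \<Otimes>\<^sub>M M \<rightarrow>\<^sub>M M"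
    and sets_homothet: "S \<in> sets M \<Longrightarrow> t \<in> E \<Longrightarrow> c \<noteq> 0 \<Longrightarrow> homothet t c S \<in> sets M"
    and emeasure_homothet: "S \<in> sets M \<Longrightarrow> t \<in> E \<Longrightarrow> c \<noteq> 0 \<Longrightarrow>
       emeasure M (homothet t c S) = ennreal (\<bar>c\<bar> ^ d) * emeasure M S"
begin

lemma fmeasurable_homothet:
  "S \<in> fmeasurable M \<Longrightarrow> t \<in> E \<Longrightarrow> c \<noteq> 0 \<Longrightarrow> homothet t c S \<in> fmeasurable M"
  by (auto simp: fmeasurable_def sets_homothet emeasure_homothet ennreal_mult_less_top)

lemma measure_homothet:
  "S \<in> fmeasurable M \<Longrightarrow> t \<in> E \<Longrightarrow> c \<noteq> 0 \<Longrightarrow>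
     measure M (homothet t c S) = \<bar>c\<bar> ^ d * measure M S"
  by (simp add: measure_def emeasure_homothet fmeasurableD enn2real_mult)

text \<open>
  The function \<open>f = (\<Sum>a\<in>A. indicator (a + l K))\<close> is supported in \<open>D = (1 + l) K\<close>, so the integral of its
  square, which adds up the volumes of all pairwise intersections, is at least the square of its
  integral divided by the volume of \<open>D\<close>. Hence the sets \<open>b + l K\<close> meet some fixed \<open>a + l K\<close> in much
  volume on average. Moving the intersection by \<open>- b\<close> turns it into the set of \<open>y \<in> l K\<close> with
  \<open>b \<in> (a - y) + l K\<close>, so that one \<open>y\<close> serves many \<open>b\<close> at once.
\<close>

lemma translate_capturing_many_points:
  assumes K: "convex K" "K \<in> fmeasurable M" "K \<subseteq> E" "0 < measure M K"
    and A: "finite A" "A \<subseteq> K" and l: "0 < l"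
  shows "\<exists>z\<in>E. (l / (1 + l)) ^ d * card A \<le> card {a \<in> A. a \<in> homothet z l K}"
proof (cases "A = {}")
  case True
  then show ?thesis using subspace_E by (auto intro: subspace_0)
next
  case False
  define m where "m = measure M K"
  define T where "T a = homothet a l K" for a
  define D where "D = homothet 0 (1 + l) K"
  \<comment> \<open>The mean of \<open>f\<close> over \<open>D\<close>; it is also the number of points to be captured.\<close>
  define q where "q = (l / (1 + l)) ^ d * card A"
  have AE: "a \<in> E" if "a \<in> A" for a using that A K by auto
  have m: "m > 0" using K by (simp add: m_def)
  have T: "T a \<in> fmeasurable M" "measure M (T a) = l ^ d * m" if "a \<in> A" for a
    using AE[OF that] l K by (auto simp: T_def m_def fmeasurable_homothet measure_homothet)
  have D: "D \<in> fmeasurable M" "measure M D = (1 + l) ^ d * m"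
    using l K subspace_0[OF subspace_E] by (auto simp: D_def m_def fmeasurable_homothet measure_homothet)
  have TD: "T a \<subseteq> D" if "a \<in> A" for a
  proof
    fix x assume "x \<in> T a"
    then obtain k where k: "k \<in> K" "x = a + l *\<^sub>R k" by (auto simp: T_def elim: homothetE)
    have "a \<in> homothet 0 1 K" using that A by (auto intro: homothetI)
    moreover have "l *\<^sub>R k \<in> homothet 0 l K" using k by (auto intro: homothetI)
    ultimately have "a + l *\<^sub>R k \<in> homothet (0 + 0) (1 + l) K"
      by (rule homothet_add_subset[OF K(1) zero_less_one l])
    then show "x \<in> D" by (simp add: k D_def)
  qed
  have TT: "T a \<inter> T b \<in> fmeasurable M" if "a \<in> A" "b \<in> A" for a b
    using T that by (auto intro: fmeasurable.Int)
  have int: "integrable M (indicator S :: 'a \<Rightarrow> real)" "integral\<^sup>L M (indicator S) = measure M S"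
    if "S \<in> fmeasurable M" for S
    using that by (auto simp: fmeasurable_def space_eq_UNIV)
  \<comment> \<open>Cauchy-Schwarz in the form that the variance of \<open>f\<close> over \<open>D\<close> is nonnegative.\<close>
  have "0 \<le> (\<integral>y. ((\<Sum>a\<in>A. indicator (T a) y) - q * indicator D y)\<^sup>2 \<partial>M)"
    by (rule integral_nonneg_AE) auto
  also have "\<dots> = (\<integral>y. (\<Sum>a\<in>A. \<Sum>b\<in>A. indicator (T a \<inter> T b) y)
      - 2 * q * (\<Sum>a\<in>A. indicator (T a) y) + q\<^sup>2 * indicator D y \<partial>M)"
  proof (rule Bochner_Integration.integral_cong[OF refl])
    fix y
    have "(\<Sum>a\<in>A. indicator (T a) y :: real) * indicator D y = (\<Sum>a\<in>A. indicator (T a) y)"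
    proof -
      have "(indicator (T a) y :: real) * indicator D y = indicator (T a) y" if "a \<in> A" for a
        using TD[OF that] by (auto simp: indicator_def)
      then show ?thesis unfolding sum_distrib_right by (intro sum.cong) auto
    qed
    moreover have "(\<Sum>a\<in>A. indicator (T a) y :: real)\<^sup>2 = (\<Sum>a\<in>A. \<Sum>b\<in>A. indicator (T a \<inter> T b) y)"
      by (simp add: power2_eq_square sum_product indicator_inter_arith)
    moreover have "(indicator D y :: real)\<^sup>2 = indicator D y"
      by (auto simp: indicator_def)
    ultimately show "((\<Sum>a\<in>A. indicator (T a) y :: real) - q * indicator D y)\<^sup>2
      = (\<Sum>a\<in>A. \<Sum>b\<in>A. indicator (T a \<inter> T b) y)
      - 2 * q * (\<Sum>a\<in>A. indicator (T a) y) + q\<^sup>2 * indicator D y"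
      by (simp add: power2_diff power_mult_distrib algebra_simps)
  qed
  also have "\<dots> = (\<Sum>a\<in>A. \<Sum>b\<in>A. measure M (T a \<inter> T b))
      - 2 * q * (\<Sum>a\<in>A. measure M (T a)) + q\<^sup>2 * measure M D"
  proof -
    have i1: "integrable M (\<lambda>y. \<Sum>a\<in>A. \<Sum>b\<in>A. indicator (T a \<inter> T b) y :: real)"
      by (intro Bochner_Integration.integrable_sum int TT)
    have i2: "integrable M (\<lambda>y. \<Sum>a\<in>A. indicator (T a) y :: real)"
      by (intro Bochner_Integration.integrable_sum int T)
    have i3: "integrable M (indicator D :: 'a \<Rightarrow> real)"
      by (intro int D)
    have e1: "(\<integral>y. (\<Sum>a\<in>A. \<Sum>b\<in>A. indicator (T a \<inter> T b) y :: real) \<partial>M) = (\<Sum>a\<in>A. \<Sum>b\<in>A. measure M (T a \<inter> T b))"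
      by (subst Bochner_Integration.integral_sum)
         (auto intro!: sum.cong Bochner_Integration.integrable_sum simp: int TT Bochner_Integration.integral_sum)
    have e2: "(\<integral>y. (\<Sum>a\<in>A. indicator (T a) y :: real) \<partial>M) = (\<Sum>a\<in>A. measure M (T a))"
      by (subst Bochner_Integration.integral_sum) (auto intro!: sum.cong simp: int T)
    show ?thesis
      using i1 i2 i3 by (simp add: e1 e2 int D)
  qed
  also have "\<dots> = (\<Sum>a\<in>A. \<Sum>b\<in>A. measure M (T a \<inter> T b)) - real (card A) * (q * (l ^ d * m))"
  proof -
    have "(1 + l) ^ d * q = card A * l ^ d" using l by (simp add: q_def power_divide)
    then have "q\<^sup>2 * measure M D = real (card A) * (q * (l ^ d * m))"
      by (simp add: D power2_eq_square mult_ac)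
    then show ?thesis by (simp add: T)
  qed
  finally have "real (card A) * (q * (l ^ d * m)) \<le> (\<Sum>a\<in>A. \<Sum>b\<in>A. measure M (T a \<inter> T b))" by simp
  then obtain a where a: "a \<in> A" "q * (l ^ d * m) \<le> (\<Sum>b\<in>A. measure M (T a \<inter> T b))"
    using sum_strict_mono[OF A(1) False, of "\<lambda>a. \<Sum>b\<in>A. measure M (T a \<inter> T b)" "\<lambda>_. q * (l ^ d * m)"]
    by (force simp: not_le)
  \<comment> \<open>This translation reverses the sign of \<open>a - b\<close>, leading to a copy of \<open>l K\<close> instead of \<open>- l K\<close>.\<close>
  define B where "B b = homothet (- b) 1 (T a \<inter> T b)" for b
  define R where "R = homothet 0 l K"
  have R: "R \<in> fmeasurable M" "measure M R = l ^ d * m"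
    using l K subspace_0[OF subspace_E] by (auto simp: R_def m_def fmeasurable_homothet measure_homothet)
  have B_eq: "B b = {y \<in> R. b + y \<in> T a}" for b
  proof -
    have "x \<in> B b \<longleftrightarrow> b + x \<in> T a \<inter> T b" for x
      unfolding B_def by (auto simp: homothet_def image_iff algebra_simps intro!: bexI[of _ "b + x"])
    moreover have "b + x \<in> T b \<longleftrightarrow> x \<in> R" for x
      by (auto simp: T_def R_def homothet_def)
    ultimately show ?thesis by auto
  qed
  have B: "B b \<in> fmeasurable M" "measure M (B b) = measure M (T a \<inter> T b)" if "b \<in> A" for b
    using TT[OF a(1) that] subspace_neg[OF subspace_E AE[OF that]]
    by (auto simp: B_def fmeasurable_homothet measure_homothet)
  define n where "n y = card {b \<in> A. b + y \<in> T a}" for y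
  have "K \<noteq> {}" using m by (auto simp: m_def)
  then obtain y0 where "y0 \<in> R" by (auto simp: R_def homothet_def)
  moreover have "\<forall>y. y \<in> R \<longrightarrow> n y < Suc (card A)"
    using A by (auto simp: n_def less_Suc_eq_le intro: card_mono)
  ultimately obtain y where y: "y \<in> R" "\<And>x. x \<in> R \<Longrightarrow> n x \<le> n y"
    using ex_has_greatest_nat[of "\<lambda>y. y \<in> R" y0 n "Suc (card A)"] by auto
  have "q * (l ^ d * m) \<le> (\<Sum>b\<in>A. measure M (B b))"
    using a B by simp
  also have "\<dots> = (\<integral>x. (\<Sum>b\<in>A. indicator (B b) x) \<partial>M)"
    by (subst Bochner_Integration.integral_sum) (auto simp: int B)
  also have "\<dots> \<le> (\<integral>x. real (n y) * indicator R x \<partial>M)"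
  proof (rule integral_mono)
    fix x
    have "(\<Sum>b\<in>A. indicator (B b) x :: real) = indicator R x * n x"
      using A by (simp add: B_eq indicator_def n_def sum.If_cases Int_def)
    then show "(\<Sum>b\<in>A. indicator (B b) x) \<le> real (n y) * indicator R x"
      using y by (auto simp: indicator_def)
  qed (auto intro!: int B R)
  also have "\<dots> = n y * (l ^ d * m)" by (simp add: int R)
  finally have "q \<le> n y" using l m by simp
  also have "n y = card {b \<in> A. b \<in> homothet (a - y) l K}"
  proof -
    have "b + y \<in> T a \<longleftrightarrow> b \<in> homothet (a - y) l K" for b
      by (auto simp: T_def algebra_simps homothet_def image_iff)
    then show ?thesis by (simp add: n_def)
  qed
  finally have "(l / (1 + l)) ^ d * card A \<le> card {b \<in> A. b \<in> homothet (a - y) l K}"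
    by (simp add: q_def)
  moreover have "a - y \<in> E"
  proof -
    obtain k where "k \<in> K" "y = l *\<^sub>R k" using y by (auto simp: R_def homothet_def)
    then show ?thesis using AE[OF a(1)] K subspace_E by (auto intro!: subspace_diff subspace_scale)
  qed
  ultimately show ?thesis by blast
qed

text \<open>
  Each step captures the fraction \<open>(l / (1 + l)) ^ d\<close> of the points still uncovered, and a set with
  fewer than one point is empty.
\<close>

lemma greedy_cover:
  assumes K: "convex K" "K \<in> fmeasurable M" "K \<subseteq> E" "0 < measure M K"
    and l: "0 < l" and "finite A" "A \<subseteq> K" "(1 - (l / (1 + l)) ^ d) ^ k * card A < 1"
  shows "\<exists>Z\<subseteq>E. finite Z \<and> card Z \<le> k \<and> A \<subseteq> (\<Union>z\<in>Z. homothet z l K)"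
  using assms(6-8)
proof (induction k arbitrary: A)
  case 0
  then have "A = {}" by auto
  then show ?case by auto
next
  case (Suc k)
  let ?p = "(l / (1 + l)) ^ d"
  have p: "?p \<le> 1" using l by (intro power_le_one) auto
  obtain z where z: "z \<in> E" "?p * card A \<le> card {a \<in> A. a \<in> homothet z l K}"
    using translate_capturing_many_points[OF K _ _ l] Suc.prems by blast
  define A' where "A' = {a \<in> A. a \<notin> homothet z l K}"
  have "card A = card {a \<in> A. a \<in> homothet z l K} + card A'"
    using Suc.prems(1) unfolding A'_def
    by (subst card_Un_disjoint[symmetric]) (auto intro!: arg_cong[where f = card])
  then have "card A' \<le> (1 - ?p) * card A" using z by (simp add: algebra_simps)
  then have "(1 - ?p) ^ k * card A' \<le> (1 - ?p) ^ k * ((1 - ?p) * card A)"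
    using p by (intro mult_left_mono) auto
  also have "\<dots> = (1 - ?p) ^ Suc k * card A" by (simp add: algebra_simps)
  also have "\<dots> < 1" by (rule Suc.prems)
  finally have "(1 - ?p) ^ k * card A' < 1" .
  moreover have "finite A'" "A' \<subseteq> K" using Suc.prems by (auto simp: A'_def)
  ultimately obtain Z where Z: "Z \<subseteq> E" "finite Z" "card Z \<le> k" "A' \<subseteq> (\<Union>z\<in>Z. homothet z l K)"
    using Suc.IH[of A'] by blast
  have "A \<subseteq> (\<Union>z\<in>insert z Z. homothet z l K)"
    using Z(4) by (auto simp: A'_def)
  moreover have "card (insert z Z) \<le> Suc k" using Z by (simp add: card_insert_if)
  ultimately show ?case using Z z by (intro exI[of _ "insert z Z"]) auto
qed

text \<open>
  The volumes of the sets \<open>K \<inter> (z - K)\<close> integrate over \<open>z\<close> to the square of the volume of \<open>K\<close>, and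
  only \<open>z \<in> 2 K\<close> contribute; so they are on average at least the volume of \<open>K\<close> divided by \<open>2 ^ d\<close>.
  Centred at \<open>c = z / 2\<close>, such an intersection is symmetric. The constant \<open>3\<close> in place of \<open>2\<close> leaves
  room for a strict inequality, and costs only a bounded factor in the base of the net size.
\<close>

lemma symmetric_section:
  assumes K: "convex K" "K \<in> fmeasurable M" "K \<subseteq> E" "0 < measure M K" and d: "0 < d"
  shows "\<exists>c\<in>E. {x. c + x \<in> K \<and> c - x \<in> K} \<in> fmeasurable M \<and>
      measure M K \<le> 3 ^ d * measure M {x. c + x \<in> K \<and> c - x \<in> K}"
proof -
  have KM [measurable]: "K \<in> sets M" using K by auto
  note diff_measurable [measurable]
  define h where "h z = emeasure M (K \<inter> {y. z - y \<in> K})" for z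
  have meas: "(\<lambda>(z, y). indicator K y * indicator K (z - y) :: ennreal) \<in> borel_measurable (M \<Otimes>\<^sub>M M)"
  proof -
    have "(\<lambda>w. indicator K (snd w) * indicator K (case w of (z, y) \<Rightarrow> z - y) :: ennreal) \<in> borel_measurable (M \<Otimes>\<^sub>M M)"
      by measurable
    then show ?thesis by (simp add: case_prod_beta)
  qed
  interpret pair_sigma_finite M M ..
  have slice: "{y. z - y \<in> K} \<in> sets M" for z
  proof -
    have "(\<lambda>y. z - y) \<in> M \<rightarrow>\<^sub>M M"
      using measurable_compose[OF measurable_Pair1'[of z M M] diff_measurable]
      by (simp add: space_eq_UNIV)
    from measurable_sets[OF this KM] show ?thesis by (simp add: space_eq_UNIV vimage_def)
  qed
  have "(\<integral>\<^sup>+z. h z \<partial>M) = (\<integral>\<^sup>+z. \<integral>\<^sup>+y. indicator K y * indicator K (z - y) \<partial>M \<partial>M)"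
  proof (rule nn_integral_cong)
    fix z
    have "h z = (\<integral>\<^sup>+y. indicator (K \<inter> {y. z - y \<in> K}) y \<partial>M)"
      unfolding h_def using slice by (subst nn_integral_indicator) auto
    also have "\<dots> = (\<integral>\<^sup>+y. indicator K y * indicator K (z - y) \<partial>M)"
      by (intro nn_integral_cong) (auto simp: indicator_def)
    finally show "h z = (\<integral>\<^sup>+y. indicator K y * indicator K (z - y) \<partial>M)" .
  qed
  also have "\<dots> = (\<integral>\<^sup>+y. \<integral>\<^sup>+z. indicator K y * indicator K (z - y) \<partial>M \<partial>M)"
    using Fubini'[OF meas] by simp
  also have "\<dots> = (\<integral>\<^sup>+y. emeasure M K * indicator K y \<partial>M)"
  proof (rule nn_integral_cong)
    fix y
    show "(\<integral>\<^sup>+z. indicator K y * indicator K (z - y) \<partial>M) = emeasure M K * indicator K y"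
    proof (cases "y \<in> K")
      case True
      have "(\<integral>\<^sup>+z. indicator K y * indicator K (z - y) \<partial>M) = (\<integral>\<^sup>+z. indicator (homothet y 1 K) z \<partial>M)"
        using True by (intro nn_integral_cong) (auto simp: indicator_def homothet_def image_iff algebra_simps)
      also have "\<dots> = emeasure M K"
        using sets_homothet[OF KM, of y 1] emeasure_homothet[OF KM, of y 1] True K by auto
      finally show ?thesis using True by simp
    qed simp
  qed
  also have "\<dots> = emeasure M K * emeasure M K"
    using KM by (simp add: nn_integral_cmult_indicator)
  finally have Fubini: "(\<integral>\<^sup>+z. h z \<partial>M) = emeasure M K * emeasure M K" .
  obtain m where m: "emeasure M K = ennreal m" "m > 0"
    using K by (metis emeasure_eq_measure2)
  define W where "W = homothet 0 2 K"
  have W: "W \<in> sets M" "emeasure M W = ennreal (2 ^ d) * ennreal m"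
    using sets_homothet[OF KM subspace_0[OF subspace_E], of 2]
      emeasure_homothet[OF KM subspace_0[OF subspace_E], of 2] by (auto simp: W_def m)
  have hW: "h z = 0" if "z \<notin> W" for z
  proof -
    have "K \<inter> {y. z - y \<in> K} = {}"
    proof (rule ccontr)
      assume "K \<inter> {y. z - y \<in> K} \<noteq> {}"
      then obtain y where y: "y \<in> K" "z - y \<in> K" by auto
      have "y + (z - y) \<in> homothet (0 + 0) (1 + 1) K"
        using y by (intro homothet_add_subset K) (auto intro: homothetI)
      then show False using that by (simp add: W_def)
    qed
    then show ?thesis by (simp add: h_def)
  qed
  have "\<exists>z. ennreal (m / 3 ^ d) \<le> h z"
  proof (rule ccontr)
    assume "\<nexists>z. ennreal (m / 3 ^ d) \<le> h z"
    then have "h z \<le> ennreal (m / 3 ^ d) * indicator W z" for z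
      using hW[of z] by (cases "z \<in> W") (auto simp: not_le less_imp_le)
    then have "(\<integral>\<^sup>+z. h z \<partial>M) \<le> (\<integral>\<^sup>+z. ennreal (m / 3 ^ d) * indicator W z \<partial>M)"
      by (intro nn_integral_mono) auto
    also have "\<dots> = ennreal (m / 3 ^ d) * (ennreal (2 ^ d) * ennreal m)"
      using W by (simp add: nn_integral_cmult_indicator)
    also have "\<dots> = ennreal ((2 / 3) ^ d * (m * m))"
      using m by (simp add: ennreal_mult' [symmetric] power_divide mult_ac)
    also have "\<dots> < ennreal (m * m)"
      using m d by (intro ennreal_lessI) (auto simp: power_less_one_iff)
    finally show False using m by (simp add: Fubini ennreal_mult')
  qed
  then obtain z where z: "ennreal (m / 3 ^ d) \<le> h z" by blast
  have zW: "z \<in> W"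
  proof (rule ccontr)
    assume "z \<notin> W"
    then have "m / 3 ^ d \<le> 0" using z hW[of z] by (simp add: ennreal_eq_0_iff)
    moreover have "0 < m / 3 ^ d" using m by simp
    ultimately show False by linarith
  qed
  then obtain c where c: "c \<in> K" "z = 2 *\<^sub>R c" by (auto simp: W_def homothet_def)
  let ?L = "{x. c + x \<in> K \<and> c - x \<in> K}"
  have L: "K \<inter> {y. z - y \<in> K} \<in> sets M" using slice[of z] by auto
  have cE: "- c \<in> E" using c K subspace_neg[OF subspace_E] by auto
  have L_eq: "?L = homothet (- c) 1 (K \<inter> {y. z - y \<in> K})"
  proof (intro set_eqI iffI)
    fix x assume "x \<in> ?L"
    then show "x \<in> homothet (- c) 1 (K \<inter> {y. z - y \<in> K})"
      by (intro homothetI[where x = "c + x"]) (auto simp: c scaleR_2)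
  qed (auto simp: c scaleR_2 algebra_simps homothet_def)
  have Lset: "?L \<in> sets M" unfolding L_eq by (rule sets_homothet[OF L cE]) simp
  have Lm: "emeasure M ?L = h z"
    unfolding L_eq h_def by (subst emeasure_homothet[OF L cE]) simp_all
  have "h z \<le> emeasure M K" unfolding h_def by (intro emeasure_mono) auto
  then have Lf: "?L \<in> fmeasurable M"
    using Lset Lm m by (intro fmeasurableI) (auto simp: less_top[symmetric] top_unique)
  have "m / 3 ^ d \<le> measure M ?L"
    using z unfolding Lm[symmetric] emeasure_eq_measure2[OF Lf] by (subst (asm) ennreal_le_iff) auto
  moreover have "measure M K = m" using m by (simp add: measure_def)
  ultimately have "measure M K \<le> 3 ^ d * measure M ?L" by (simp add: field_simps)
  then show ?thesis using Lf c K by blast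
qed

text \<open>
  A maximal packing of sets \<open>a + (e / 2) L\<close>, with \<open>L\<close> the symmetric part of \<open>K - c\<close>. By maximality
  every \<open>x \<in> K\<close> satisfies \<open>x - a \<in> (e / 2) (L - L)\<close> for some \<open>a\<close>, and by symmetry and convexity
  this set is \<open>e L\<close>, which is contained in \<open>e (K - c)\<close>. Packing copies of \<open>K\<close> itself would leave
  the larger set \<open>(e / 2) (K - K)\<close> instead.
\<close>

lemma small_net:
  assumes K: "convex K" "K \<in> fmeasurable M" "K \<subseteq> E" "0 < measure M K"
    and d: "0 < d" and e: "0 < e" "e \<le> 1"
  shows "\<exists>A c. finite A \<and> A \<subseteq> K \<and> c \<in> E \<and> card A \<le> (9 / e) ^ d \<and>
      K \<subseteq> (\<Union>a\<in>A. homothet (a - e *\<^sub>R c) e K)"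
proof -
  obtain c where c: "c \<in> E" and "{x. c + x \<in> K \<and> c - x \<in> K} \<in> fmeasurable M"
    "measure M K \<le> 3 ^ d * measure M {x. c + x \<in> K \<and> c - x \<in> K}"
    using symmetric_section[OF K d] by (elim bexE conjE) (rule that)
  moreover define L where "L = {x. c + x \<in> K \<and> c - x \<in> K}"
  ultimately have L: "L \<in> fmeasurable M" "measure M K \<le> 3 ^ d * measure M L" by auto
  have L0: "0 < measure M L"
  proof (rule ccontr)
    assume "\<not> 0 < measure M L"
    then have "measure M L = 0" using measure_nonneg[of M L] by linarith
    then show False using L K by simp
  qed
  define P where "P a = homothet a (e / 2) L" for a
  have PS: "P a \<in> fmeasurable M" "measure M (P a) = (e / 2) ^ d * measure M L" if "a \<in> K" for a
    using that K e L by (auto simp: P_def fmeasurable_homothet measure_homothet)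
  let ?D = "homothet (- ((e / 2) *\<^sub>R c)) (1 + e / 2) K"
  have "- ((e / 2) *\<^sub>R c) \<in> E" using c subspace_E by (intro subspace_neg subspace_scale)
  then have D: "?D \<in> fmeasurable M" "measure M ?D = (1 + e / 2) ^ d * measure M K"
    using e K by (auto simp: fmeasurable_homothet measure_homothet)
  have PD: "P a \<subseteq> ?D" if "a \<in> K" for a
  proof
    fix x assume "x \<in> P a"
    then obtain y where y: "c + y \<in> K" "x = a + (e / 2) *\<^sub>R y" by (auto simp: P_def L_def homothet_def)
    have "a + (- ((e / 2) *\<^sub>R c) + (e / 2) *\<^sub>R (c + y)) \<in> homothet (0 + - ((e / 2) *\<^sub>R c)) (1 + e / 2) K"
      using that e y by (intro homothet_add_subset K) (auto intro: homothetI)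
    then show "x \<in> ?D" by (simp add: y algebra_simps)
  qed
  define packing where "packing A \<longleftrightarrow> finite A \<and> A \<subseteq> K \<and> disjoint_family_on P A" for A
  have bound: "card A \<le> (9 / e) ^ d" if "packing A" for A
  proof -
    have A: "finite A" "A \<subseteq> K" "disjoint_family_on P A" using that by (auto simp: packing_def)
    have "card A * ((e / 2) ^ d * measure M L) = (\<Sum>a\<in>A. measure M (P a))"
      using A PS by (simp add: subset_iff)
    also have "\<dots> = measure M (\<Union>a\<in>A. P a)"
      using A PS by (intro measure_finite_Union[symmetric]) (auto simp: emeasure_eq_measure2 image_subset_iff subset_iff)
    also have "\<dots> \<le> measure M ?D"
      using A PS PD D by (intro measure_mono_fmeasurable sets.finite_UN) (auto simp: subset_iff)
    also have "\<dots> \<le> (1 + e / 2) ^ d * (3 ^ d * measure M L)"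
      using D L e by (intro order.trans[OF eq_refl[OF D(2)]] mult_left_mono) auto
    finally have "card A * (e / 2) ^ d \<le> (1 + e / 2) ^ d * 3 ^ d"
      using L0 by (simp add: mult.assoc[symmetric])
    then have "card A \<le> (1 + e / 2) ^ d * 3 ^ d / (e / 2) ^ d"
      using e by (intro pos_le_divide_eq[THEN iffD2]) simp_all
    also have "\<dots> = ((1 + e / 2) * 3 / (e / 2)) ^ d"
      by (simp only: power_mult_distrib power_divide)
    also have "\<dots> \<le> (9 / e) ^ d"
      using e by (intro power_mono) (auto simp: field_simps)
    finally show ?thesis .
  qed
  have "packing {}" by (simp add: packing_def disjoint_family_on_def)
  moreover have "card A < Suc (nat \<lfloor>(9 / e) ^ d\<rfloor>)" if "packing A" for A
    using bound[OF that] e by (simp add: less_Suc_eq_le le_nat_floor)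
  ultimately obtain A where A: "packing A" "\<And>B. packing B \<Longrightarrow> card B \<le> card A"
    using ex_has_greatest_nat[of packing "{}" card "Suc (nat \<lfloor>(9 / e) ^ d\<rfloor>)"] by auto
  have L_half: "(1/2) *\<^sub>R (x - y) \<in> L" if "x \<in> L" "y \<in> L" for x y
  proof -
    have "(1/2) *\<^sub>R (c + x) + (1/2) *\<^sub>R (c - y) \<in> K" "(1/2) *\<^sub>R (c - x) + (1/2) *\<^sub>R (c + y) \<in> K"
      using that by (auto simp: L_def intro!: convexD[OF K(1)])
    moreover have "(1/2) *\<^sub>R (c + x) + (1/2) *\<^sub>R (c - y) = c + (1/2) *\<^sub>R (x - y)"
      and "(1/2) *\<^sub>R (c - x) + (1/2) *\<^sub>R (c + y) = c - (1/2) *\<^sub>R (x - y)"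
      using scaleR_half_double[of c] by (simp_all add: algebra_simps)
    ultimately show ?thesis by (simp add: L_def)
  qed
  have "K \<subseteq> (\<Union>a\<in>A. homothet (a - e *\<^sub>R c) e K)"
  proof
    fix x assume x: "x \<in> K"
    have "\<exists>a\<in>A. P a \<inter> P x \<noteq> {}"
    proof (rule ccontr)
      assume *: "\<not> (\<exists>a\<in>A. P a \<inter> P x \<noteq> {})"
      have "L \<noteq> {}" using L0 by auto
      then have "P x \<noteq> {}" by (simp add: P_def homothet_def)
      then have "x \<notin> A" using * by auto
      moreover from this have "packing (insert x A)"
        using A(1) x * by (auto simp: packing_def disjoint_family_on_insert)
      ultimately show False using A(2)[of "insert x A"] A(1) by (auto simp: packing_def)
    qed
    then obtain a u v where a: "a \<in> A" and u: "u \<in> L" "v \<in> L" "a + (e / 2) *\<^sub>R u = x + (e / 2) *\<^sub>R v"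
      by (auto simp: P_def homothet_def)
    define w where "w = (1/2) *\<^sub>R (u - v)"
    have "w \<in> L" unfolding w_def using u by (intro L_half)
    then have "c + w \<in> K" by (simp add: L_def)
    moreover have "x = a + e *\<^sub>R w"
      using u(3) by (simp add: w_def algebra_simps)
    then have "x = (a - e *\<^sub>R c) + e *\<^sub>R (c + w)" by (simp add: algebra_simps)
    ultimately show "x \<in> (\<Union>a\<in>A. homothet (a - e *\<^sub>R c) e K)" using a by (blast intro: homothetI)
  qed
  then show ?thesis using A(1) bound[OF A(1)] c by (auto simp: packing_def)
qed

text \<open>
  The translates of \<open>l K\<close> with \<open>l = 1 - 2 * e\<close> that cover the net grow by \<open>e (K - c)\<close> to homothets of
  ratio \<open>1 - e\<close> that cover \<open>K\<close>; \<open>1 + l = 2 - 2 * e\<close> explains the fraction in the hypothesis.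
\<close>

lemma homothet_cover:
  assumes K: "convex K" "K \<in> fmeasurable M" "K \<subseteq> E" "0 < measure M K"
    and d: "0 < d" and e: "0 < e" "e < 1 / 2"
    and k: "(1 - ((1 - 2 * e) / (2 - 2 * e)) ^ d) ^ k * (9 / e) ^ d < 1"
  shows "\<exists>Z\<subseteq>E. finite Z \<and> card Z \<le> k \<and> K \<subseteq> (\<Union>z\<in>Z. homothet z (1 - e) K)"
proof -
  obtain A c where A: "finite A" "A \<subseteq> K" "c \<in> E" "card A \<le> (9 / e) ^ d"
      "K \<subseteq> (\<Union>a\<in>A. homothet (a - e *\<^sub>R c) e K)"
    using small_net[OF K d, of e] e by auto
  define l where "l = 1 - 2 * e"
  have l: "0 < l" "1 + l = 2 - 2 * e" "l + e = 1 - e" using e by (auto simp: l_def)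
  have "(l / (1 + l)) ^ d \<le> 1" using l by (intro power_le_one) auto
  then have "(1 - (l / (1 + l)) ^ d) ^ k * card A \<le> (1 - (l / (1 + l)) ^ d) ^ k * (9 / e) ^ d"
    using A by (intro mult_left_mono) auto
  also have "\<dots> < 1" using k unfolding l(2) by (simp add: l_def)
  finally have "(1 - (l / (1 + l)) ^ d) ^ k * card A < 1" .
  from greedy_cover[OF K l(1) A(1,2) this] obtain Z
    where Z: "Z \<subseteq> E" "finite Z" "card Z \<le> k" "A \<subseteq> (\<Union>z\<in>Z. homothet z l K)"
    by (elim exE conjE) (rule that)
  let ?Z = "(\<lambda>z. z - e *\<^sub>R c) ` Z"
  have "K \<subseteq> (\<Union>z\<in>?Z. homothet z (1 - e) K)"
  proof
    fix x assume "x \<in> K"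
    then obtain a y where a: "a \<in> A" "y \<in> K" "x = a + (- (e *\<^sub>R c) + e *\<^sub>R y)"
      using A(5) by (fastforce simp: algebra_simps homothet_def)
    obtain z where z: "z \<in> Z" "a \<in> homothet z l K" using Z a by blast
    have "x \<in> homothet (z + - (e *\<^sub>R c)) (l + e) K"
      unfolding a(3) using z a e l by (intro homothet_add_subset K) (auto intro: homothetI)
    then show "x \<in> (\<Union>z\<in>?Z. homothet z (1 - e) K)" using z by (auto simp: l(3))
  qed
  moreover have "?Z \<subseteq> E" using Z A subspace_E by (auto intro!: subspace_diff subspace_scale)
  moreover have "card ?Z \<le> k" using card_image_le[OF Z(2), of "\<lambda>z. z - e *\<^sub>R c"] Z(3) by linarith
  ultimately show ?thesis using Z(2) by blast
qed

end

section \<open>Volume on the coordinate space\<close>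

instantiation "fun" :: (type, scaleR) scaleR
begin

definition scaleR_fun :: "real \<Rightarrow> ('a \<Rightarrow> 'b) \<Rightarrow> 'a \<Rightarrow> 'b" where
  "scaleR_fun c f = (\<lambda>x. c *\<^sub>R f x)"

instance ..

end

instance "fun" :: (type, real_vector) real_vector
  by standard (simp_all add: scaleR_fun_def fun_eq_iff scaleR_add_right scaleR_add_left)

text \<open>
  The product of the Lebesgue measures lives on functions that are \<^const>\<open>undefined\<close> from index \<open>d\<close>
  on; pushing it forward to functions that vanish there makes the underlying set a subspace.
\<close>

definition volume_measure :: "nat \<Rightarrow> (nat \<Rightarrow> real) measure" where
  "volume_measure d =
     distr (Pi\<^sub>M {..<d} (\<lambda>_. lborel)) borel (\<lambda>f i. if i < d then f i else 0)"

lemma coordinate_borel_measurable [measurable]: "(\<lambda>x. x i) \<in> borel_measurable (borel :: (nat \<Rightarrow> real) measure)"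
  by (intro borel_measurable_continuous_onI continuous_on_product_coordinates)

lemma component_measurable [measurable]:
  "i < d \<Longrightarrow> (\<lambda>f. f i) \<in> borel_measurable (Pi\<^sub>M {..<d} (\<lambda>_. lborel :: real measure))"
  using measurable_component_singleton[of i "{..<d}" "\<lambda>_. lborel :: real measure"] by simp

lemma extend_measurable [measurable]:
  "(\<lambda>f i. if i < d then f i else 0) \<in> Pi\<^sub>M {..<d} (\<lambda>_. lborel) \<rightarrow>\<^sub>M (borel :: (nat \<Rightarrow> real) measure)"
proof (rule measurable_coordinatewise_then_product)
  fix i
  show "(\<lambda>f. if i < d then f i else 0 :: real) \<in> borel_measurable (Pi\<^sub>M {..<d} (\<lambda>_. lborel))"
    by (cases "i < d") auto
qed

lemma sets_volume_measure [measurable_cong, simp]: "sets (volume_measure d) = sets borel"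
  by (simp add: volume_measure_def)

lemma space_volume_measure [simp]: "space (volume_measure d) = UNIV"
  by (simp add: volume_measure_def)

text \<open>
  Both sides are measures in \<open>S\<close>, so it suffices to compare them on boxes, where the identity is the
  product of the one-dimensional ones.
\<close>

lemma emeasure_PiM_lborel_affine:
  fixes t :: "nat \<Rightarrow> real"
  assumes c: "c \<noteq> 0" and S: "S \<in> sets (Pi\<^sub>M {..<d} (\<lambda>_. lborel))"
  shows "emeasure (Pi\<^sub>M {..<d} (\<lambda>_. lborel)) S = ennreal (\<bar>c\<bar> ^ d) *
     emeasure (Pi\<^sub>M {..<d} (\<lambda>_. lborel))
       ((\<lambda>f. \<lambda>i\<in>{..<d}. t i + c * f i) -` S \<inter> space (Pi\<^sub>M {..<d} (\<lambda>_. lborel)))"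
proof -
  let ?M = "Pi\<^sub>M {..<d} (\<lambda>_. lborel :: real measure)"
  let ?T = "\<lambda>f. \<lambda>i\<in>{..<d}. t i + c * f i"
  interpret product_sigma_finite "\<lambda>_::nat. lborel :: real measure" ..
  have T [measurable]: "?T \<in> ?M \<rightarrow>\<^sub>M ?M"
    by (rule measurable_restrict) (simp add: component_measurable)
  have "scale_measure (ennreal (\<bar>c\<bar> ^ d)) (distr ?M ?M ?T) = ?M"
  proof (rule PiM_eqI)
    fix A :: "nat \<Rightarrow> real set"
    assume A: "\<And>i. i \<in> {..<d} \<Longrightarrow> A i \<in> sets lborel"
    have AP: "Pi\<^sub>E {..<d} A \<in> sets ?M" using A by (intro sets_PiM_I_finite) auto
    have V: "(\<lambda>x. t i + c * x) -` A i \<in> sets lborel" if "i < d" for i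
      using A[of i] that measurable_sets[of "\<lambda>x. t i + c * x" lborel borel "A i"] by auto
    have one: "ennreal \<bar>c\<bar> * emeasure lborel ((\<lambda>x. t i + c * x) -` A i) = emeasure lborel (A i)" if "i < d" for i
      using A[of i] that
      by (subst (2) lborel_real_affine[OF c, of "t i"]) (simp add: emeasure_density_const emeasure_distr)
    have "?T -` Pi\<^sub>E {..<d} A \<inter> space ?M = Pi\<^sub>E {..<d} (\<lambda>i. (\<lambda>x. t i + c * x) -` A i)"
      by (auto simp: space_PiM PiE_iff)
    then have "emeasure (scale_measure (ennreal (\<bar>c\<bar> ^ d)) (distr ?M ?M ?T)) (Pi\<^sub>E {..<d} A)
      = ennreal (\<bar>c\<bar> ^ d) * (\<Prod>i<d. emeasure lborel ((\<lambda>x. t i + c * x) -` A i))"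
      using V AP emeasure_PiM[of "{..<d}" "\<lambda>i. (\<lambda>x. t i + c * x) -` A i"] by (simp add: emeasure_distr)
    also have "\<dots> = (\<Prod>i<d. ennreal \<bar>c\<bar> * emeasure lborel ((\<lambda>x. t i + c * x) -` A i))"
      by (simp add: prod.distrib ennreal_power)
    also have "\<dots> = (\<Prod>i<d. emeasure lborel (A i))"
      by (intro prod.cong) (auto simp: one)
    finally show "emeasure (scale_measure (ennreal (\<bar>c\<bar> ^ d)) (distr ?M ?M ?T)) (Pi\<^sub>E {..<d} A)
      = (\<Prod>i<d. emeasure lborel (A i))" .
  qed simp_all
  from arg_cong[OF this, of "\<lambda>N. emeasure N S"] show ?thesis
    using S by (simp add: emeasure_distr)
qed

lemma emeasure_volume_measure:
  assumes "S \<in> sets borel"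
  shows "emeasure (volume_measure d) S = emeasure (Pi\<^sub>M {..<d} (\<lambda>_. lborel))
    ((\<lambda>f i. if i < d then f i else 0) -` S \<inter> space (Pi\<^sub>M {..<d} (\<lambda>_. lborel)))"
  using assms by (simp add: volume_measure_def emeasure_distr)

lemma homothet_eq_vimage:
  assumes "c \<noteq> 0"
  shows "homothet t c S = (\<lambda>x. inverse c *\<^sub>R (x - t)) -` S"
proof (intro set_eqI iffI)
  fix x
  assume "x \<in> (\<lambda>x. inverse c *\<^sub>R (x - t)) -` S"
  then show "x \<in> homothet t c S"
    using assms by (intro homothetI[where x = "inverse c *\<^sub>R (x - t)"]) simp_all
qed (use assms in \<open>auto elim!: homothetE\<close>)

lemma coordinate_box:
  shows "{x :: nat \<Rightarrow> real. \<forall>i<d. \<bar>x i\<bar> \<le> r} \<in> sets borel"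
    and "0 \<le> r \<Longrightarrow> emeasure (volume_measure d) {x. \<forall>i<d. \<bar>x i\<bar> \<le> r} = ennreal ((2 * r) ^ d)"
proof -
  show B: "{x :: nat \<Rightarrow> real. \<forall>i<d. \<bar>x i\<bar> \<le> r} \<in> sets borel"
    by measurable
  interpret product_sigma_finite "\<lambda>_::nat. lborel :: real measure" ..
  assume r: "0 \<le> r"
  have "(\<lambda>f i. if i < d then f i else 0) -` {x. \<forall>i<d. \<bar>x i\<bar> \<le> r} \<inter> space (Pi\<^sub>M {..<d} (\<lambda>_. lborel))
      = Pi\<^sub>E {..<d} (\<lambda>_. {-r..r})"
  proof -
    have "\<bar>y\<bar> \<le> r \<longleftrightarrow> y \<in> {-r..r}" for y :: real by auto
    then show ?thesis by (auto simp: space_PiM PiE_iff simp del: atLeastAtMost_iff)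
  qed
  then show "emeasure (volume_measure d) {x. \<forall>i<d. \<bar>x i\<bar> \<le> r} = ennreal ((2 * r) ^ d)"
    using r emeasure_PiM[of "{..<d}" "\<lambda>_. {-r..r}"]
    unfolding emeasure_volume_measure[OF B] by (simp add: ennreal_power)
qed

interpretation volume: homogeneous_measure "volume_measure d" "topspace (Euclidean_space d)" d for d
proof
  have "range (\<lambda>n::nat. {x :: nat \<Rightarrow> real. \<forall>i<d. \<bar>x i\<bar> \<le> real n}) \<subseteq> sets (volume_measure d)"
    using coordinate_box(1) by auto
  moreover have "(\<Union>n::nat. {x :: nat \<Rightarrow> real. \<forall>i<d. \<bar>x i\<bar> \<le> real n}) = UNIV"
  proof -
    have "\<exists>n::nat. \<forall>i<d. \<bar>x i\<bar> \<le> real n" for x :: "nat \<Rightarrow> real"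
    proof -
      obtain n where n: "(\<Sum>i<d. \<bar>x i\<bar>) \<le> real n" using real_arch_simple by blast
      have "\<bar>x i\<bar> \<le> (\<Sum>i<d. \<bar>x i\<bar>)" if "i < d" for i
        using that by (intro member_le_sum) auto
      then show ?thesis using n by (meson order.trans)
    qed
    then show ?thesis by auto
  qed
  moreover have "emeasure (volume_measure d) {x. \<forall>i<d. \<bar>x i\<bar> \<le> real n} \<noteq> \<infinity>" for n
    by (simp add: coordinate_box(2))
  ultimately show "\<exists>A. countable A \<and> A \<subseteq> sets (volume_measure d) \<and> \<Union> A = space (volume_measure d) \<and>
      (\<forall>a\<in>A. emeasure (volume_measure d) a \<noteq> \<infinity>)"
    by (intro exI[of _ "range (\<lambda>n::nat. {x :: nat \<Rightarrow> real. \<forall>i<d. \<bar>x i\<bar> \<le> real n})"]) auto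
next
  show "space (volume_measure d) = UNIV" by simp
next
  show "subspace (topspace (Euclidean_space d))"
    by (auto simp: subspace_def topspace_Euclidean_space scaleR_fun_def)
next
  have "(\<lambda>(x, y). x - y) \<in> (borel \<Otimes>\<^sub>M borel) \<rightarrow>\<^sub>M (borel :: (nat \<Rightarrow> real) measure)"
    by (rule measurable_coordinatewise_then_product) (simp add: case_prod_beta fun_diff_def)
  then show "(\<lambda>(x, y). x - y) \<in> volume_measure d \<Otimes>\<^sub>M volume_measure d \<rightarrow>\<^sub>M volume_measure d"
    by (simp cong: measurable_cong_sets sets_pair_measure_cong)
next
  fix S :: "(nat \<Rightarrow> real) set" and t :: "nat \<Rightarrow> real" and c :: real
  assume S: "S \<in> sets (volume_measure d)" and t: "t \<in> topspace (Euclidean_space d)" and c: "c \<noteq> 0"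
  have "(\<lambda>x. inverse c *\<^sub>R (x - t)) \<in> borel \<rightarrow>\<^sub>M (borel :: (nat \<Rightarrow> real) measure)"
    by (rule measurable_coordinatewise_then_product) (simp add: scaleR_fun_def fun_diff_def)
  from measurable_sets[OF this, of S] show H: "homothet t c S \<in> sets (volume_measure d)"
    using S c by (simp add: homothet_eq_vimage)
  let ?g = "\<lambda>f i. if i < d then f i else (0::real)"
  let ?M = "Pi\<^sub>M {..<d} (\<lambda>_. lborel :: real measure)"
  have g: "?g (\<lambda>i\<in>{..<d}. t i + c * f i) = t + c *\<^sub>R ?g f" for f
    using t by (auto simp: fun_eq_iff scaleR_fun_def topspace_Euclidean_space)
  have mem: "t + c *\<^sub>R x \<in> homothet t c S \<longleftrightarrow> x \<in> S" for x
    using c by (auto simp: homothet_def)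
  have "(\<lambda>f. \<lambda>i\<in>{..<d}. t i + c * f i) -` (?g -` homothet t c S \<inter> space ?M) \<inter> space ?M
    = ?g -` S \<inter> space ?M"
  proof -
    have "(\<lambda>i\<in>{..<d}. t i + c * f i) \<in> space ?M" for f by (simp add: space_PiM)
    then show ?thesis unfolding vimage_def using g mem by auto
  qed
  then show "emeasure (volume_measure d) (homothet t c S) = ennreal (\<bar>c\<bar> ^ d) * emeasure (volume_measure d) S"
    using H S emeasure_PiM_lborel_affine[OF c measurable_sets[OF extend_measurable], of "homothet t c S" d t]
    by (simp add: emeasure_volume_measure)
qed

text \<open>
  A body has positive volume because its blow-ups about an interior point exhaust the whole space:
  if it were null, then so would be a countable union of blow-ups, which is everything.
\<close>

lemma convex_body_volume:
  assumes "convex_body d K"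
  shows "convex K" "K \<in> fmeasurable (volume_measure d)" "K \<subseteq> topspace (Euclidean_space d)"
    "0 < measure (volume_measure d) K"
proof -
  have comp: "compactin (Euclidean_space d) K" using assms by (simp add: convex_body_def)
  have KE: "K \<subseteq> topspace (Euclidean_space d)" by (rule compactin_subset_topspace[OF comp])
  then show "K \<subseteq> topspace (Euclidean_space d)" .
  show "convex K"
  proof -
    have "u *\<^sub>R x + v *\<^sub>R y = (\<lambda>i. u * x i + v * y i)" for u v :: real and x y :: "nat \<Rightarrow> real"
      by (simp add: fun_eq_iff scaleR_fun_def)
    then show ?thesis using assms by (simp add: convex_def convex_body_def)
  qed
  have K: "compact K"
    using comp by (simp add: Euclidean_space_def compactin_subtopology euclidean_product_topology)
  then have KM: "K \<in> sets (volume_measure d)"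
    by (simp add: compact_imp_closed)
  have "\<exists>b. \<forall>x\<in>K. \<bar>x i\<bar> \<le> b" for i
  proof -
    have "continuous_on K (\<lambda>x. x i)"
      using continuous_on_product_coordinates by (rule continuous_on_subset) simp
    then have "bounded ((\<lambda>x. x i) ` K)"
      using K by (intro compact_imp_bounded compact_continuous_image)
    then show ?thesis by (simp add: bounded_iff)
  qed
  then have "\<forall>i. \<exists>b. \<forall>x\<in>K. \<bar>x i\<bar> \<le> b" by (rule allI)
  from choice[OF this] obtain b where b: "\<forall>i. \<forall>x\<in>K. \<bar>x i\<bar> \<le> b i" by (elim exE) (rule that)
  have "\<bar>x i\<bar> \<le> (\<Sum>i<d. \<bar>b i\<bar>)" if "x \<in> K" "i < d" for x i
  proof -
    have "\<bar>x i\<bar> \<le> \<bar>b i\<bar>" using b that by (meson abs_ge_self order.trans)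
    also have "\<dots> \<le> (\<Sum>i<d. \<bar>b i\<bar>)" using that by (intro member_le_sum) auto
    finally show ?thesis .
  qed
  then have "K \<subseteq> {x. \<forall>i<d. \<bar>x i\<bar> \<le> (\<Sum>i<d. \<bar>b i\<bar>)}" by auto
  then have "emeasure (volume_measure d) K \<le> emeasure (volume_measure d) {x. \<forall>i<d. \<bar>x i\<bar> \<le> (\<Sum>i<d. \<bar>b i\<bar>)}"
    by (intro emeasure_mono) (simp_all add: coordinate_box)
  also have "\<dots> < \<infinity>" by (simp add: coordinate_box(2) sum_nonneg)
  finally show KF: "K \<in> fmeasurable (volume_measure d)" using KM by (intro fmeasurableI) auto
  obtain c U where U: "openin (Euclidean_space d) U" "c \<in> U" "U \<subseteq> K"
    using assms by (auto simp: convex_body_def interior_of_def)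
  then obtain V where V: "open V" "U = topspace (Euclidean_space d) \<inter> V"
    by (auto simp: Euclidean_space_def openin_subtopology euclidean_product_topology)
  have cE: "c \<in> topspace (Euclidean_space d)" using U KE by auto
  let ?H = "\<lambda>n. homothet (- (real (Suc n) *\<^sub>R c)) (real (Suc n)) K"
  have H: "?H n \<in> sets (volume_measure d)" "emeasure (volume_measure d) (?H n) = ennreal (real (Suc n) ^ d) * emeasure (volume_measure d) K" for n
    using volume.sets_homothet[OF KM, of "- (real (Suc n) *\<^sub>R c)" "real (Suc n)"]
      volume.emeasure_homothet[OF KM, of "- (real (Suc n) *\<^sub>R c)" "real (Suc n)"]
      volume.subspace_E[of d] cE by (auto simp del: of_nat_Suc intro: subspace_neg subspace_scale)
  have cover: "topspace (Euclidean_space d) \<subseteq> (\<Union>n. ?H n)"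
  proof
    fix x assume x: "x \<in> topspace (Euclidean_space d)"
    have "continuous_on UNIV (\<lambda>t. c + t *\<^sub>R x)"
      by (rule continuous_on_coordinatewise_then_product) (auto simp: scaleR_fun_def intro!: continuous_intros)
    then have "open ((\<lambda>t::real. c + t *\<^sub>R x) -` V)" using V by (intro open_vimage)
    moreover have "0 \<in> (\<lambda>t::real. c + t *\<^sub>R x) -` V" using U V by simp
    ultimately have "eventually (\<lambda>n. inverse (real (Suc n)) \<in> (\<lambda>t::real. c + t *\<^sub>R x) -` V) sequentially"
      using LIMSEQ_inverse_real_of_nat by (rule topological_tendstoD[rotated])
    then obtain n where "c + inverse (real (Suc n)) *\<^sub>R x \<in> V"
      by (auto simp: eventually_sequentially simp del: of_nat_Suc)
    moreover have "c + inverse (real (Suc n)) *\<^sub>R x \<in> topspace (Euclidean_space d)"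
      using x cE volume.subspace_E[of d] by (intro subspace_add subspace_scale)
    ultimately have "c + inverse (real (Suc n)) *\<^sub>R x \<in> K" using U V by auto
    then have "x \<in> ?H n"
      by (rule homothetI) (simp add: scaleR_add_right del: of_nat_Suc)
    then show "x \<in> (\<Union>n. ?H n)" by blast
  qed
  let ?P = "Pi\<^sub>M {..<d} (\<lambda>_. lborel :: real measure)"
  show "0 < measure (volume_measure d) K"
  proof (rule ccontr)
    assume "\<not> 0 < measure (volume_measure d) K"
    then have "measure (volume_measure d) K = 0" using measure_nonneg[of "volume_measure d" K] by linarith
    then have "emeasure (volume_measure d) K = 0" using emeasure_eq_measure2[OF KF] by simp
    then have "?H n \<in> null_sets (volume_measure d)" for n using H[of n] by (intro null_setsI) auto
    then have "(\<Union>n. ?H n) \<in> null_sets (volume_measure d)" by (intro null_sets_UN)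
    then have 0: "emeasure (volume_measure d) (\<Union>n. ?H n) = 0" by auto
    have "ennreal ((2 * 1) ^ d) = emeasure (volume_measure d) {x. \<forall>i<d. \<bar>x i\<bar> \<le> 1}"
      by (subst coordinate_box(2)) auto
    also have "\<dots> \<le> emeasure ?P (space ?P)"
      unfolding emeasure_volume_measure[OF coordinate_box(1)] by (rule emeasure_space)
    also have "space ?P =
        (\<lambda>f i. if i < d then f i else 0) -` (\<Union>n. ?H n) \<inter> space ?P"
    proof -
      have "(\<lambda>i. if i < d then f i else 0) \<in> (\<Union>n. ?H n)" for f :: "nat \<Rightarrow> real"
        by (rule subsetD[OF cover]) (simp add: topspace_Euclidean_space)
      then show ?thesis by blast
    qed
    also have "emeasure ?P \<dots> = emeasure (volume_measure d) (\<Union>n. ?H n)"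
    proof (rule emeasure_volume_measure[symmetric])
      show "(\<Union>n. ?H n) \<in> sets borel" using H(1) by (intro sets.countable_UN) auto
    qed
    finally show False using 0 by simp
  qed
qed

lemma max_covering_number_le:
  fixes e :: real
  assumes d: "0 < d" and e: "0 < e" "e < 1 / 2"
    and k: "(1 - ((1 - 2 * e) / (2 - 2 * e)) ^ d) ^ k * (9 / e) ^ d < 1"
  shows "max_covering_number d \<le> enat k"
  unfolding max_covering_number_def
proof (rule SUP_least)
  fix K assume "K \<in> {K. convex_body d K}"
  then have K: "convex_body d K" by simp
  obtain Z where Z: "Z \<subseteq> topspace (Euclidean_space d)" "finite Z" "card Z \<le> k" "K \<subseteq> (\<Union>z\<in>Z. homothet z (1 - e) K)"
    using volume.homothet_cover[OF convex_body_volume[OF K] d e k] by (elim exE conjE) (rule that)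
  define F where "F = (\<lambda>z. homothet z (1 - e) K) ` Z"
  have "smaller_homothet d K S" if "S \<in> F" for S
  proof -
    obtain z where z: "z \<in> Z" "S = homothet z (1 - e) K" using \<open>S \<in> F\<close> by (auto simp: F_def)
    have "S = (\<lambda>x i. z i + (1 - e) * x i) ` K"
      by (simp add: z homothet_def scaleR_fun_def plus_fun_def)
    then show ?thesis unfolding smaller_homothet_def using z Z e
      by (intro bexI[of _ z] exI[of _ "1 - e"]) auto
  qed
  then have "covering_number d K \<le> enat (card F)"
    unfolding covering_number_def using Z by (intro Inf_lower) (auto simp: F_def)
  also have "\<dots> \<le> enat k"
    using Z(3) card_image_le[OF Z(2), of "\<lambda>z. homothet z (1 - e) K"] by (simp add: F_def)
  finally show "covering_number d K \<le> enat k" .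
qed

section \<open>The cube\<close>

definition unit_cube :: "nat \<Rightarrow> (nat \<Rightarrow> real) set" where
  "unit_cube d = {x. (\<forall>i<d. 0 \<le> x i \<and> x i \<le> 1) \<and> (\<forall>i\<ge>d. x i = 0)}"

lemma convex_body_unit_cube: "convex_body d (unit_cube d)"
  unfolding convex_body_def
proof (intro conjI ballI allI impI)
  have eq: "unit_cube d = Pi\<^sub>E UNIV (\<lambda>i. if i < d then {0..1} else {0})"
  proof (intro set_eqI iffI)
    fix x :: "nat \<Rightarrow> real"
    assume "x \<in> Pi\<^sub>E UNIV (\<lambda>i. if i < d then {0..1} else {0})"
    then have x: "x i \<in> (if i < d then {0..1} else {0})" for i by (simp add: PiE_UNIV_domain Pi_iff)
    have "0 \<le> x i \<and> x i \<le> 1" if "i < d" for i using x[of i] that by simp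
    moreover have "x i = 0" if "d \<le> i" for i using x[of i] that by simp
    ultimately show "x \<in> unit_cube d" by (simp add: unit_cube_def)
  qed (simp add: PiE_UNIV_domain Pi_iff unit_cube_def)
  have "compactin (powertop_real UNIV) (unit_cube d)"
    unfolding eq compactin_PiE by simp
  moreover have "unit_cube d \<subseteq> {x. \<forall>i\<ge>d. x i = 0}" by (auto simp: unit_cube_def)
  ultimately show "compactin (Euclidean_space d) (unit_cube d)"
    by (simp add: Euclidean_space_def compactin_subtopology)
next
  fix x y :: "nat \<Rightarrow> real" and u v :: real
  assume "x \<in> unit_cube d" "y \<in> unit_cube d" and uv: "0 \<le> u" "0 \<le> v" "u + v = 1"
  moreover have "u * x i + v * y i \<le> 1" if "x i \<le> 1" "y i \<le> 1" for i
    using convex_bound_le[OF that uv] .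
  ultimately show "(\<lambda>i. u * x i + v * y i) \<in> unit_cube d"
    by (auto simp: unit_cube_def)
next
  define V :: "(nat \<Rightarrow> real) set" where "V = (\<Inter>i<d. (\<lambda>x. x i) -` {0<..<1})"
  have "open V"
    unfolding V_def by (intro open_INT open_vimage ballI) (auto intro: continuous_on_product_coordinates)
  then have "openin (Euclidean_space d) (topspace (Euclidean_space d) \<inter> V)"
    by (auto simp: Euclidean_space_def openin_subtopology euclidean_product_topology)
  moreover have "topspace (Euclidean_space d) \<inter> V \<subseteq> unit_cube d"
    by (auto simp: V_def unit_cube_def topspace_Euclidean_space less_imp_le)
  ultimately have "topspace (Euclidean_space d) \<inter> V \<subseteq> Euclidean_space d interior_of unit_cube d"
    by (rule interior_of_maximal[rotated])
  moreover have "(\<lambda>i. if i < d then 1 / 2 else 0) \<in> topspace (Euclidean_space d) \<inter> V"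
    by (auto simp: V_def topspace_Euclidean_space)
  ultimately show "Euclidean_space d interior_of unit_cube d \<noteq> {}" by blast
qed

text \<open>
  Two distinct vertices differ by \<open>1\<close> in some coordinate, while a homothet of ratio \<open>l < 1\<close> has
  width \<open>l\<close> in each coordinate. Hence members of a covering chosen to contain the vertices, here
  indexed by subsets of \<open>{..<d}\<close>, are distinct.
\<close>

lemma covering_number_unit_cube: "enat (2 ^ d) \<le> covering_number d (unit_cube d)"
  unfolding covering_number_def
proof (rule Inf_greatest)
  fix N assume "N \<in> {enat (card F) |F. finite F \<and> (\<forall>S\<in>F. smaller_homothet d (unit_cube d) S) \<and> unit_cube d \<subseteq> \<Union> F}"
  then obtain F where F: "N = enat (card F)" "finite F" "\<And>S. S \<in> F \<Longrightarrow> smaller_homothet d (unit_cube d) S" "unit_cube d \<subseteq> \<Union> F"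
    by auto
  define v :: "nat set \<Rightarrow> nat \<Rightarrow> real" where "v I i = (if i \<in> I then 1 else 0)" for I i
  have "v I \<in> unit_cube d" if "I \<in> Pow {..<d}" for I
    using that by (auto simp: v_def unit_cube_def)
  then have "v I \<in> \<Union> F" if "I \<in> Pow {..<d}" for I
    using that by (intro subsetD[OF F(4)])
  then have "\<forall>I\<in>Pow {..<d}. \<exists>S\<in>F. v I \<in> S" by (simp add: Union_iff)
  then have "\<exists>f. \<forall>I\<in>Pow {..<d}. f I \<in> F \<and> v I \<in> f I" unfolding Bex_def by (rule bchoice)
  then obtain f where f: "\<And>I. I \<in> Pow {..<d} \<Longrightarrow> f I \<in> F" "\<And>I. I \<in> Pow {..<d} \<Longrightarrow> v I \<in> f I"
    by auto
  have separated: "I \<subseteq> J" if IJ: "I \<in> Pow {..<d}" "J \<in> Pow {..<d}" "f I = f J" for I J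
  proof
    fix i assume i: "i \<in> I"
    obtain z l where l: "0 < l" "l < 1" "f I = (\<lambda>x i. z i + l * x i) ` unit_cube d"
      using F(3)[OF f(1)[OF IJ(1)]] by (auto simp: smaller_homothet_def)
    obtain x y where xy: "x \<in> unit_cube d" "y \<in> unit_cube d"
      "v I = (\<lambda>i. z i + l * x i)" "v J = (\<lambda>i. z i + l * y i)"
      using f(2)[OF IJ(1)] f(2)[OF IJ(2)] unfolding IJ(3)[symmetric] l(3) by auto
    have "i < d" using i IJ by auto
    then have "x i \<le> 1" "0 \<le> y i" using xy by (auto simp: unit_cube_def)
    have "v I i - v J i = l * (x i - y i)" unfolding xy(3,4) by (simp add: algebra_simps)
    also have "\<dots> \<le> l * 1" using \<open>x i \<le> 1\<close> \<open>0 \<le> y i\<close> l(1) by (intro mult_left_mono) auto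
    finally show "i \<in> J" using l(2) i by (auto simp: v_def split: if_splits)
  qed
  have "inj_on f (Pow {..<d})"
    using separated by (intro inj_onI equalityI) auto
  then have "card (Pow {..<d}) \<le> card F"
    using f(1) F(2) by (intro card_inj_on_le[of f]) auto
  then show "enat (2 ^ d) \<le> N" by (simp add: F(1) card_Pow)
qed

lemma max_covering_number_ge: "enat (2 ^ d) \<le> max_covering_number d"
proof -
  have "covering_number d (unit_cube d) \<le> max_covering_number d"
    unfolding max_covering_number_def using convex_body_unit_cube by (intro SUP_upper) auto
  then show ?thesis using covering_number_unit_cube order.trans by blast
qed

section \<open>Asymptotics\<close>

text \<open>
  With \<open>p\<close> the captured proportion, \<open>k > d * ln (9 / e) / p\<close> steps suffice since
  \<open>(1 - p) ^ k \<le> exp (- p * k)\<close>, and \<open>1 / p = (2 * (1 - e) / (1 - 2 * e)) ^ d \<le> (2 * exp (2 * e)) ^ d\<close>.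
\<close>

lemma max_covering_number_le_real:
  fixes e :: real
  assumes d: "0 < d" and e: "0 < e" "e \<le> 1 / 4"
  shows "ereal_of_enat (max_covering_number d)
    \<le> ereal (2 ^ d * exp (2 * e * real d) * (real d * ln (9 / e)) + 1)"
proof -
  define p where "p = ((1 - 2 * e) / (2 - 2 * e)) ^ d"
  define y where "y = real d * ln (9 / e) / p"
  define k where "k = Suc (nat \<lfloor>y\<rfloor>)"
  have p: "0 < p" "p \<le> 1" using e by (auto simp: p_def intro!: power_le_one)
  have ln0: "0 \<le> ln (9 / e)" using e by simp
  then have y0: "0 \<le> y" using p by (simp add: y_def)
  have k: "y < real k" "real k \<le> y + 1" using y0 by (auto simp: k_def) linarith+
  have "real d * ln (9 / e) < p * real k" using k(1) p by (simp add: y_def field_simps)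
  have "(1 - p) ^ k \<le> exp (- p) ^ k"
    using p exp_ge_add_one_self[of "- p"] by (intro power_mono) auto
  also have "\<dots> = exp (- (p * k))" by (simp add: exp_of_nat_mult[symmetric] mult.commute)
  finally have "(1 - p) ^ k * (9 / e) ^ d \<le> exp (- (p * k)) * (9 / e) ^ d"
    using e by (intro mult_right_mono) auto
  also have "\<dots> = exp (- (p * k)) * exp (real d * ln (9 / e))" using e by (simp add: exp_of_nat_mult)
  also have "\<dots> < 1"
    using \<open>real d * ln (9 / e) < p * real k\<close> by (simp add: exp_add[symmetric])
  finally have "(1 - p) ^ k * (9 / e) ^ d < 1" .
  then have "max_covering_number d \<le> enat k"
    using d e unfolding p_def by (intro max_covering_number_le) auto
  then have "ereal_of_enat (max_covering_number d) \<le> ereal (real k)"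
    using ereal_of_enat_le_iff[of "max_covering_number d" "enat k"] by simp
  also have "real k \<le> 2 ^ d * exp (2 * e * real d) * (real d * ln (9 / e)) + 1"
  proof -
    have "8 * e * e \<le> 2 * e" using e mult_right_mono[of e "1 / 4" "8 * e"] by simp
    then have "(2 - 2 * e) / (1 - 2 * e) \<le> 2 * (1 + 2 * e)"
      using e by (simp add: field_simps)
    also have "\<dots> \<le> 2 * exp (2 * e)"
      using exp_ge_add_one_self[of "2 * e"] by (intro mult_left_mono) auto
    finally have "((2 - 2 * e) / (1 - 2 * e)) ^ d \<le> (2 * exp (2 * e)) ^ d"
      using e by (intro power_mono) auto
    also have "\<dots> = 2 ^ d * exp (2 * e * real d)"
      by (simp add: power_mult_distrib exp_of_nat_mult[symmetric] mult_ac)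
    also have "((2 - 2 * e) / (1 - 2 * e)) ^ d = 1 / p" by (simp add: p_def power_divide)
    finally have "(1 / p) * (real d * ln (9 / e)) \<le> 2 ^ d * exp (2 * e * real d) * (real d * ln (9 / e))"
      using ln0 by (intro mult_right_mono) auto
    then show ?thesis using k(2) by (simp add: y_def)
  qed
  finally show ?thesis by simp
qed

text \<open>
  The choice \<open>e = 1 / (d * ln d)\<close> balances the two losses: \<open>exp (2 * e * d) = 1 + O(1 / ln d)\<close> is
  multiplied by \<open>d * ln (9 / e)\<close>, which is about \<open>d * ln d\<close>, so that its excess over \<open>1\<close> only adds
  \<open>O(d)\<close>. A much larger \<open>e\<close> would spoil this, and a much smaller one would raise \<open>ln (1 / e)\<close>.
\<close>

lemma max_covering_number_asymptotic:
  assumes d: "4 \<le> ln (real d)"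
  shows "ereal_of_enat (max_covering_number d)
    \<le> ereal (2 ^ d * (real d * ln (real d) + real d * ln (ln (real d)) + 25 * real d))"
proof -
  define L where "L = ln (real d)"
  define e where "e = 1 / (real d * L)"
  have L: "4 \<le> L" using d by (simp add: L_def)
  have d0: "0 < d" using d by (cases "d = 0") auto
  then have d1: "1 \<le> real d" by simp
  have dL: "4 \<le> real d * L" using mult_mono[OF d1 L] by simp
  have e: "0 < e" "e \<le> 1 / 4" using dL by (auto simp: e_def field_simps)
  have lnL: "0 \<le> ln L" "ln L \<le> L" using L ln_le_minus_one[of L] by auto
  have ln9: "ln (9 / e) \<le> 8 + L + ln L"
  proof -
    have "9 / e = 9 * (real d * L)" by (simp add: e_def)
    also have "ln \<dots> = ln 9 + ln (real d * L)" using L d0 by (intro ln_mult_pos) auto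
    also have "ln (real d * L) = ln (real d) + ln L" using L d0 by (intro ln_mult_pos) auto
    also have "ln (real d) = L" by (simp only: L_def)
    finally show ?thesis using ln_le_minus_one[of 9] by simp
  qed
  have "exp (2 * e * real d) = exp (2 / L)" using d1 by (simp add: e_def)
  also have "\<dots> \<le> 1 + 2 / L + (2 / L)\<^sup>2" using L by (intro exp_bound) auto
  also have "\<dots> \<le> 1 + 4 / L"
  proof -
    have "(2 / L) * (2 / L) \<le> 1 * (2 / L)" using L by (intro mult_right_mono) auto
    then show ?thesis by (simp add: power2_eq_square)
  qed
  finally have exp: "exp (2 * e * real d) \<le> 1 + 4 / L" .
  have "exp (2 * e * real d) * ln (9 / e) \<le> (1 + 4 / L) * (8 + L + ln L)"
    using exp ln9 e L by (intro mult_mono) auto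
  also have "\<dots> = 12 + L + ln L + (32 + 4 * ln L) / L"
    using L by (simp add: field_simps)
  also have "(32 + 4 * ln L) / L \<le> 12"
  proof -
    have "32 + 4 * ln L \<le> 12 * L" using lnL L by simp
    then show ?thesis using L by (simp add: pos_divide_le_eq)
  qed
  finally have "exp (2 * e * real d) * ln (9 / e) \<le> L + ln L + 24" by simp
  then have "(2 ^ d * real d) * (exp (2 * e * real d) * ln (9 / e)) \<le> (2 ^ d * real d) * (L + ln L + 24)"
    by (intro mult_left_mono) auto
  moreover have "1 \<le> 2 ^ d * real d"
    using mult_mono[of 1 "2 ^ d" 1 "real d"] d1 by simp
  ultimately have "2 ^ d * exp (2 * e * real d) * (real d * ln (9 / e)) + 1
      \<le> 2 ^ d * (real d * L + real d * ln L + 25 * real d)"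
    by (simp add: algebra_simps)
  then show ?thesis
    using max_covering_number_le_real[OF d0 e] order.trans unfolding L_def by (metis ereal_less_eq(3))
qed

theorem theorem2:
  shows "(\<exists>C>0. \<exists>d0::nat. \<forall>d\<ge>d0.
            ereal_of_enat (max_covering_number d)
              \<le> ereal (2 ^ d * (real d * ln (real d) + real d * ln (ln (real d)) + C * real d)))
       \<and> (\<exists>C'>0. \<exists>d1::nat. \<forall>d\<ge>d1.
            ereal (2 powr (real d - C' * ln (real d))) \<le> ereal_of_enat (max_covering_number d)
            \<and> ereal_of_enat (max_covering_number d) \<le> ereal (2 powr (real d + C' * ln (real d))))"
proof -
  define d0 :: nat where "d0 = nat \<lceil>exp 4 :: real\<rceil>"
  have d0: "4 \<le> ln (real d)" "9 \<le> real d" if "d \<ge> d0" for d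
  proof -
    have "exp 4 \<le> real d" using that unfolding d0_def by linarith
    moreover have "(9::real) \<le> exp 4"
    proof -
      have "(3::real) * 3 \<le> exp 2 * exp 2"
        using exp_ge_add_one_self[of 2] by (intro mult_mono) auto
      then show ?thesis by (simp add: exp_add[symmetric])
    qed
    ultimately show "4 \<le> ln (real d)" "9 \<le> real d" by (auto simp: ln_ge_iff)
  qed
  \<comment> \<open>For \<open>C' = 3 / ln 2\<close>, \<open>2 powr (C' * ln d)\<close> is \<open>d ^ 3\<close>, which dominates the factor \<open>O(d * ln d)\<close>.\<close>
  have "ereal (2 powr (real d - 3 / ln 2 * ln (real d))) \<le> ereal_of_enat (max_covering_number d)
      \<and> ereal_of_enat (max_covering_number d) \<le> ereal (2 powr (real d + 3 / ln 2 * ln (real d)))"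
    if d: "d \<ge> d0" for d
  proof
    let ?D = "real d" let ?L = "ln (real d)"
    have pos: "0 < ?D" using d0[OF d] by simp
    have "2 powr (?D - 3 / ln 2 * ?L) \<le> 2 powr ?D"
      using d0[OF d] by (intro powr_mono) auto
    also have "\<dots> = real (2 ^ d)" by (simp add: powr_realpow)
    finally have "ereal (2 powr (?D - 3 / ln 2 * ?L)) \<le> ereal_of_enat (enat (2 ^ d))" by simp
    also have "\<dots> \<le> ereal_of_enat (max_covering_number d)"
      using max_covering_number_ge[of d] by (simp only: ereal_of_enat_le_iff)
    finally show "ereal (2 powr (?D - 3 / ln 2 * ?L)) \<le> ereal_of_enat (max_covering_number d)" .
    have "2 powr (3 / ln 2 * ?L) = ?D powr 3" using pos by (simp add: powr_def)
    also have "\<dots> = ?D ^ 3" using pos powr_realpow[of ?D 3] by simp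
    finally have P: "2 powr (?D + 3 / ln 2 * ?L) = 2 ^ d * ?D ^ 3"
      by (simp add: powr_add powr_realpow)
    have L: "4 \<le> ?L" "?L \<le> ?D" "ln ?L \<le> ?L"
      using d0[OF d] ln_le_minus_one[OF pos] ln_le_minus_one[of ?L] by auto
    have "?D * ?L + ?D * ln ?L + 25 * ?D = ?D * (?L + ln ?L + 25)" by (simp add: algebra_simps)
    also have "\<dots> \<le> ?D * (?D * ?D)"
    proof (rule mult_left_mono)
      have "9 * ?D \<le> ?D * ?D" using d0[OF d] by (intro mult_right_mono) auto
      then show "?L + ln ?L + 25 \<le> ?D * ?D" using L by linarith
    qed simp
    finally have "?D * ?L + ?D * ln ?L + 25 * ?D \<le> ?D ^ 3" by (simp add: power3_eq_cube)
    then have "ereal (2 ^ d * (?D * ?L + ?D * ln ?L + 25 * ?D)) \<le> ereal (2 powr (?D + 3 / ln 2 * ?L))"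
      unfolding P by simp
    then show "ereal_of_enat (max_covering_number d) \<le> ereal (2 powr (?D + 3 / ln 2 * ?L))"
      using max_covering_number_asymptotic[OF d0(1)[OF d]] by (rule order.trans[rotated])
  qed
  moreover have "(0::real) < 3 / ln 2" by simp
  ultimately have "\<exists>C'>0. \<exists>d1::nat. \<forall>d\<ge>d1.
            ereal (2 powr (real d - C' * ln (real d))) \<le> ereal_of_enat (max_covering_number d)
            \<and> ereal_of_enat (max_covering_number d) \<le> ereal (2 powr (real d + C' * ln (real d)))"
    by blast
  moreover have "\<exists>C>0. \<exists>d0::nat. \<forall>d\<ge>d0. ereal_of_enat (max_covering_number d)
      \<le> ereal (2 ^ d * (real d * ln (real d) + real d * ln (ln (real d)) + C * real d))"
    using max_covering_number_asymptotic d0(1) by (intro exI[of _ 25] conjI exI[of _ d0]) auto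
  ultimately show ?thesis by blast
qed

end
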